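(* Let $f(x)=(g\circ F)(x)$, where $g$ is a proper closed function on $\mathbb{R}^m$ and $F:\mathbb{R}^n\to\mathbb{R}^m$ is a continuously differentiable mapping. Suppose in addition that $g$ is a KL function with an exponent of $\alpha\in[0,1)$ and that the Jacobian $JF(\bar x)\in\mathbb{R}^{m\times n}$ is a surjective mapping at some $\bar x\in\mathrm{dom}\,\partial f$. Then $f$ has the KL property at $\bar x$ with an exponent of $\alpha$.
   Context: Closed means lower semicontinuous; proper means never $-\infty$ and not identically $+\infty$; $\mathrm{dom}\,f=\{x: f(x)<\infty\}$. For a proper function $f$ and $x\in\mathrm{dom}\,f$, the regular subdifferential is $\widehat\partial f(x)=\{v: \liminf_{z\to x,z\ne x}\frac{f(z)-f(x)-\langle v,z-x\rangle}{\|z-x\|}\ge 0\}$ and the (limiting) subdifferential $\partial f(x)$ is the set of $v$ for which there exist $x^t\to x$ with $f(x^t)\to f(x)$ and $v^t\to v$ with $v^t\in\widehat\partial f(x^t)$ for each $t$; $\partial f(x)=\emptyset$ if $x\notin\mathrm{dom}\,f$. $\mathrm{dom}\,\partial f=\{x:\partial f(x)\ne\emptyset\}$. A proper closed function $f$ has the KL property at $\bar x\in\mathrm{dom}\,\partial f$ with an exponent of $\alpha\in[0,1)$ if there exist $c,\epsilon>0$ and $\nu\in(0,\infty]$ such that $\mathrm{dist}(0,\partial f(x))\ge c\,(f(x)-f(\bar x))^\alpha$ whenever $\|x-\bar x\|\le\epsilon$ and $f(\bar x)<f(x)<f(\bar x)+\nu$ (with $\mathrm{dist}(0,\emptyset)=+\infty$).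 It is a KL function with an exponent of $\alpha$ if it has the KL property with exponent $\alpha$ at every $\bar x\in\mathrm{dom}\,\partial f$. *)

theory Defs
  imports "HOL-Analysis.Analysis"
begin

definition proper_fun :: "('a \<Rightarrow> ereal) \<Rightarrow> bool" where
  "proper_fun f \<longleftrightarrow> (\<forall>x. f x \<noteq> -\<infinity>) \<and> (\<exists>x. f x \<noteq> \<infinity>)"

definition closed_fun :: "('a::topological_space \<Rightarrow> ereal) \<Rightarrow> bool" where
  "closed_fun f \<longleftrightarrow> (\<forall>x. f x \<le> Liminf (at x) f)"

definition dom_fun :: "('a \<Rightarrow> ereal) \<Rightarrow> 'a set" where
  "dom_fun f = {x. f x < \<infinity>}"

(* The regular subdifferential is taken to be empty outside the domain. At x in the domain of
   a proper f, the quotient below never meets an undefined extended-real operation: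
   f x is finite and f z is finite or +infinity. *)
definition regular_subdiff :: "('a::euclidean_space \<Rightarrow> ereal) \<Rightarrow> 'a \<Rightarrow> 'a set" where
  "regular_subdiff f x = (if x \<in> dom_fun f
     then {v. 0 \<le> Liminf (at x)
                (\<lambda>z. (f z - f x - ereal (v \<bullet> (z - x))) / ereal (norm (z - x)))}
     else {})"

definition subdiff :: "('a::euclidean_space \<Rightarrow> ereal) \<Rightarrow> 'a \<Rightarrow> 'a set" where
  "subdiff f x = (if x \<in> dom_fun f
     then {v. \<exists>xs vs. xs \<longlonglongrightarrow> x \<and> (\<lambda>t. f (xs t)) \<longlonglongrightarrow> f x \<and> vs \<longlonglongrightarrow> v \<and>
                (\<forall>t::nat. vs t \<in> regular_subdiff f (xs t))}
     else {})"

definition dom_subdiff :: "('a::euclidean_space \<Rightarrow> ereal) \<Rightarrow> 'a set" where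
  "dom_subdiff f = {x. subdiff f x \<noteq> {}}"

(* Unlike infdist, which is 0 on the empty set, this distance to the empty set is +infinity. *)
definition edist_set :: "'a::metric_space \<Rightarrow> 'a set \<Rightarrow> ereal" where
  "edist_set x S = (INF y\<in>S. ereal (dist x y))"

(* In the inequality both f x and f xbar are finite, because f is proper, and their difference
   is positive; so powr agrees with the usual power, also for the exponent 0. *)
definition KL_property_at :: "('a::euclidean_space \<Rightarrow> ereal) \<Rightarrow> 'a \<Rightarrow> real \<Rightarrow> bool" where
  "KL_property_at f xbar \<alpha> \<longleftrightarrow>
     proper_fun f \<and> closed_fun f \<and> xbar \<in> dom_subdiff f \<and> 0 \<le> \<alpha> \<and> \<alpha> < 1 \<and>
     (\<exists>(c::real) (\<epsilon>::real) (\<nu>::ereal). 0 < c \<and> 0 < \<epsilon> \<and> 0 < \<nu> \<and>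
        (\<forall>x. norm (x - xbar) \<le> \<epsilon> \<and> f xbar < f x \<and> f x < f xbar + \<nu> \<longrightarrow>
             ereal (c * real_of_ereal (f x - f xbar) powr \<alpha>) \<le> edist_set 0 (subdiff f x)))"

definition KL_function :: "('a::euclidean_space \<Rightarrow> ereal) \<Rightarrow> real \<Rightarrow> bool" where
  "KL_function f \<alpha> \<longleftrightarrow>
     proper_fun f \<and> closed_fun f \<and> 0 \<le> \<alpha> \<and> \<alpha> < 1 \<and>
     (\<forall>xbar\<in>dom_subdiff f. KL_property_at f xbar \<alpha>)"

definition continuously_differentiable :: "(real^'n \<Rightarrow> real^'m) \<Rightarrow> bool" where
  "continuously_differentiable F \<longleftrightarrow>
     (\<forall>x. F differentiable (at x)) \<and> continuous_on UNIV (\<lambda>x. jacobian F (at x))"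

end

theory Submission
  imports Defs
begin

text \<open>
  Surjectivity of the Jacobian lets subgradients of \<open>g \<circ> F\<close> be pushed forward to subgradients of
  \<open>g\<close> at a uniformly bounded cost: near \<open>xbar\<close> there is a constant \<open>K\<close> such that every subgradient
  \<open>v\<close> of \<open>g \<circ> F\<close> at \<open>x\<close> yields a subgradient \<open>w\<close> of \<open>g\<close> at \<open>F x\<close> with \<open>norm w \<le> K * norm v\<close>.
  Then the distance from \<open>0\<close> to the subdifferential of \<open>g \<circ> F\<close> at \<open>x\<close> is at least \<open>1 / K\<close> times the
  one for \<open>g\<close> at \<open>F x\<close>, while the function values agree, so the inequality for \<open>g\<close> near \<open>F xbar\<close>
  gives the one for \<open>g \<circ> F\<close> near \<open>xbar\<close> with the same exponent and with \<open>c / K\<close> in place of \<open>c\<close>.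

  The push-forward uses a right inverse \<open>B\<close> of the derivative of \<open>F\<close> at \<open>x\<close>; the subgradient
  produced is \<open>adjoint B v\<close>. On the slice \<open>x + range B\<close> the map \<open>F\<close> has the identity as
  derivative, hence covers a neighbourhood of \<open>F x\<close>, and every lower estimate for \<open>g \<circ> F\<close> on
  the slice becomes a lower estimate for \<open>g\<close> (\<open>regular_subdiff_comp\<close>). Continuity of the Jacobian
  gives right inverses with a common bound \<open>K\<close> near \<open>xbar\<close>
  (\<open>locally_bounded_right_inverses\<close>). Because \<open>K\<close> is uniform, the pushed-forward regular subgradients
  along a sequence stay bounded, and compactness carries the estimate to limiting subgradients
  (\<open>subdiff_comp_bound\<close>).
\<close>

section \<open>Pushing regular subgradients forward\<close>

text \<open>
  Clearing the denominator trades the extended-real quotient for a first-order lower bound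
  with error \<open>e * norm (z - x)\<close>, which can be transported along maps.
\<close>
lemma regular_subdiff_iff:
  fixes f :: "'a::euclidean_space \<Rightarrow> ereal"
  assumes "f x = ereal r"
  shows "v \<in> regular_subdiff f x \<longleftrightarrow>
    (\<forall>e>0. \<forall>\<^sub>F z in at x. ereal (r + v \<bullet> (z - x) - e * norm (z - x)) \<le> f z)"
proof -
  define q where "q = (\<lambda>z. (f z - f x - ereal (v \<bullet> (z - x))) / ereal (norm (z - x)))"
  have q_ge: "ereal (-e) \<le> q z \<longleftrightarrow> ereal (r + v \<bullet> (z - x) - e * norm (z - x)) \<le> f z"
    if "z \<noteq> x" for z e
  proof -
    have "norm (z - x) > 0"
      using that by simp
    then show ?thesis
      unfolding q_def assms
      by (cases "f z") (auto simp: field_simps)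
  qed
  have "v \<in> regular_subdiff f x \<longleftrightarrow> 0 \<le> Liminf (at x) q"
    unfolding regular_subdiff_def dom_fun_def q_def using assms by simp
  also have "\<dots> \<longleftrightarrow> (\<forall>e>0. \<forall>\<^sub>F z in at x. ereal (-e) \<le> q z)"
  proof
    assume L: "0 \<le> Liminf (at x) q"
    show "\<forall>e>0. \<forall>\<^sub>F z in at x. ereal (-e) \<le> q z"
    proof (intro allI impI)
      fix e :: real
      assume "e > 0"
      then have "ereal (-e) < Liminf (at x) q"
        by (intro less_le_trans[OF _ L]) simp
      then show "\<forall>\<^sub>F z in at x. ereal (-e) \<le> q z"
        using less_LiminfD[of "ereal (-e)" "at x" q] by (auto elim: eventually_mono)
    qed
  next
    assume R: "\<forall>e>0. \<forall>\<^sub>F z in at x. ereal (-e) \<le> q z"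
    show "0 \<le> Liminf (at x) q"
    proof (rule ereal_le_epsilon2)
      fix e :: real
      assume "e > 0"
      then have "ereal (-e) \<le> Liminf (at x) q"
        using R by (intro Liminf_bounded) auto
      then show "0 \<le> Liminf (at x) q + ereal e"
        by (cases "Liminf (at x) q") auto
    qed
  qed
  also have "\<dots> \<longleftrightarrow> (\<forall>e>0. \<forall>\<^sub>F z in at x. ereal (r + v \<bullet> (z - x) - e * norm (z - x)) \<le> f z)"
    by (intro all_cong imp_cong refl eventually_cong)
       (auto simp: eventually_at_filter q_ge)
  finally show ?thesis .
qed

text \<open>
  Points \<open>y\<close> near \<open>F x\<close> can be written as \<open>y = F (x + B s)\<close> with \<open>s\<close> equal to \<open>y - F x\<close> up to an
  error of smaller order. In the lower bound for \<open>g \<circ> F\<close> at \<open>x + B s\<close> the linear term is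
  \<open>v \<bullet> B s = adjoint B v \<bullet> s\<close>, and \<open>s\<close> may be replaced by \<open>y - F x\<close>. Such an \<open>s\<close>
  exists by the open mapping theorem of Sussmann, and differentiability at \<open>x\<close> bounds it by a
  multiple of \<open>norm (y - F x)\<close>.
\<close>
lemma regular_subdiff_comp:
  fixes F :: "'a::euclidean_space \<Rightarrow> 'b::euclidean_space" and g :: "'b \<Rightarrow> ereal"
  assumes v: "v \<in> regular_subdiff (g \<circ> F) x"
    and gx: "g (F x) \<noteq> -\<infinity>"
    and cont: "continuous_on UNIV F"
    and der: "(F has_derivative A) (at x)"
    and B: "linear B" "A \<circ> B = id"
  shows "adjoint B v \<in> regular_subdiff g (F x)"
proof -
  define w where "w = adjoint B v"
  have w: "v \<bullet> B s = w \<bullet> s" for s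
    unfolding w_def using adjoint_works[OF B(1)] by (metis inner_commute)
  obtain r where r: "g (F x) = ereal r"
    using v gx by (cases "g (F x)") (auto simp: regular_subdiff_def dom_fun_def)
  obtain K where K: "K > 0" "\<And>s. norm (B s) \<le> K * norm s"
    using linear_bounded_pos[OF B(1)] by metis
  define \<Theta> where "\<Theta> s = F (x + B s)" for s
  have derT: "(\<Theta> has_derivative id) (at 0)"
  proof -
    have "(F has_derivative A) (at (x + B 0))"
      using der linear_0[OF B(1)] by simp
    moreover have "((\<lambda>s. x + B s) has_derivative B) (at 0)"
      using B(1) linear_imp_has_derivative[OF B(1)]
      by (auto intro!: derivative_eq_intros)
    ultimately show ?thesis
      unfolding \<Theta>_def using has_derivative_compose[of "\<lambda>s. x + B s" B 0 UNIV F A] B(2)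
      by (simp add: o_def)
  qed
  have contT: "continuous_on UNIV \<Theta>"
    unfolding \<Theta>_def
    by (intro continuous_on_compose2[OF cont] continuous_intros linear_continuous_on
        linear_conv_bounded_linear[THEN iffD1] B(1)) auto
  have T0: "\<Theta> 0 = F x"
    by (simp add: \<Theta>_def linear_0[OF B(1)])
  have "\<forall>\<^sub>F y in at (F x). ereal (r + w \<bullet> (y - F x) - e * norm (y - F x)) \<le> g y"
    if "e > 0" for e
  proof -
    \<comment> \<open>Let \<open>d\<close> bound the relative error in the inequality for \<open>v\<close> and in the linearization of \<open>\<Theta>\<close>.
      The former costs \<open>d * K * norm s\<close>, the latter \<open>d * norm w * norm s\<close>, and the bound \<open>1/2\<close>
      gives \<open>norm s \<le> 2 * norm (y - F x)\<close>.\<close>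
    define d where "d = min (1/2) (e / (2 * (K + norm w)))"
    have Kw: "K + norm w > 0"
      using K(1) norm_ge_zero[of w] by linarith
    have d: "d > 0" "d \<le> 1/2" and de: "2 * d * (K + norm w) \<le> e"
    proof -
      show "d > 0"
        using that Kw by (simp add: d_def)
      show "d \<le> 1/2"
        unfolding d_def by (rule min.cobounded1)
      have "d \<le> e / (2 * (K + norm w))"
        by (simp add: d_def)
      then show "2 * d * (K + norm w) \<le> e"
        using Kw by (simp add: field_simps)
    qed
    have "\<forall>\<^sub>F z in at x. ereal (r + v \<bullet> (z - x) - d * norm (z - x)) \<le> (g \<circ> F) z"
      using v d(1) regular_subdiff_iff[of "g \<circ> F" x r v] r by simp
    then obtain d1 where d1: "d1 > 0" and "\<And>z. z \<noteq> x \<Longrightarrow> dist z x < d1 \<Longrightarrow>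
        ereal (r + v \<bullet> (z - x) - d * norm (z - x)) \<le> g (F z)"
      by (auto simp: eventually_at)
    then have z: "ereal (r + v \<bullet> (z - x) - d * norm (z - x)) \<le> g (F z)"
      if "dist z x < d1" for z
      using that r by (cases "z = x") auto
    obtain d2 where d2: "d2 > 0" and s: "\<And>s. norm s < d2 \<Longrightarrow> norm (\<Theta> s - F x - s) \<le> d * norm s"
      using derT d(1) T0 unfolding has_derivative_at_alt by fastforce
    define \<rho> where "\<rho> = min (d1 / (2 * K)) (d2 / 2)"
    have \<rho>: "\<rho> > 0" "\<rho> < d2" "K * \<rho> < d1"
    proof -
      show "\<rho> > 0" "\<rho> < d2"
        using d1 d2 K by (auto simp: \<rho>_def)
      have "\<rho> \<le> d1 / (2 * K)"
        by (simp add: \<rho>_def)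
      then have "K * \<rho> \<le> d1 / 2"
        using K(1) by (simp add: field_simps)
      then show "K * \<rho> < d1"
        using d1 by simp
    qed
    have "\<Theta> 0 \<in> interior (\<Theta> ` cball 0 \<rho>)"
      using sussmann_open_mapping[of UNIV \<Theta> 0 id id "cball 0 \<rho>"] contT derT \<rho>(1)
      by (simp add: bounded_linear_ident[folded id_def])
    then have "\<forall>\<^sub>F y in at (F x). y \<in> interior (\<Theta> ` cball 0 \<rho>)"
      unfolding T0 by (intro eventually_at_in_open') auto
    then show ?thesis
    proof eventually_elim
      case (elim y)
      then obtain s where y: "y = \<Theta> s" and ns: "norm s \<le> \<rho>"
        using interior_subset by (fastforce simp: dist_norm)
      have err: "norm (y - F x - s) \<le> d * norm s"
        using s[of s] ns \<rho>(2) y by simp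
      have "norm s \<le> norm (y - F x) + norm (y - F x - s)"
        using norm_triangle_ineq4[of "y - F x" "y - F x - s"] by simp
      moreover have "d * norm s \<le> 1/2 * norm s"
        using d(2) by (intro mult_right_mono) auto
      ultimately have s2: "norm s \<le> 2 * norm (y - F x)"
        using err by linarith
      have "norm (B s) \<le> K * \<rho>"
        using K(2)[of s] ns K(1) by (meson mult_left_mono less_imp_le order_trans)
      then have "ereal (r + v \<bullet> B s - d * norm (B s)) \<le> g y"
        using z[of "x + B s"] \<rho>(3) y by (simp add: \<Theta>_def dist_norm)
      moreover have "r + w \<bullet> (y - F x) - e * norm (y - F x) \<le> r + v \<bullet> B s - d * norm (B s)"
      proof -
        have "d * norm (B s) \<le> d * K * norm s"
          using K(2)[of s] d(1) by (simp add: mult.assoc)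
        moreover have "w \<bullet> (y - F x - s) \<le> norm w * (d * norm s)"
          by (meson err norm_cauchy_schwarz mult_left_mono norm_ge_zero order_trans)
        moreover have "w \<bullet> (y - F x - s) = w \<bullet> (y - F x) - w \<bullet> s"
          by (rule inner_diff_right)
        moreover have "d * (K + norm w) * norm s \<le> e * norm (y - F x)"
        proof -
          have "d * (K + norm w) * norm s \<le> d * (K + norm w) * (2 * norm (y - F x))"
            using s2 d(1) Kw by (intro mult_left_mono) auto
          also have "\<dots> = (2 * d * (K + norm w)) * norm (y - F x)"
            by simp
          also have "\<dots> \<le> e * norm (y - F x)"
            using de by (intro mult_right_mono) auto
          finally show ?thesis .
        qed
        ultimately show ?thesis
          unfolding w by (simp add: algebra_simps)
      qed
      ultimately show ?case
        by (meson ereal_less_eq(3) order_trans)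
    qed
  qed
  then show ?thesis
    using regular_subdiff_iff[of g "F x" r w] r w_def by simp
qed

section \<open>Uniformly bounded right inverses of the Jacobian\<close>

text \<open>
  On the range of \<open>B0\<close> the map \<open>A\<close> is so close to \<open>A0\<close> that \<open>A \<circ> B0\<close> differs from the identity by
  at most \<open>1/2\<close> in operator norm. Hence it is injective, so invertible by dimension, with an inverse
  \<open>N\<close> of norm at most \<open>2\<close>; the right inverse sought is \<open>B0 \<circ> N\<close>.
\<close>
lemma right_inverse_perturbation:
  fixes A A0 :: "'a::euclidean_space \<Rightarrow> 'b::euclidean_space"
  assumes lin: "linear A" "linear B0"
    and inv: "A0 \<circ> B0 = id"
    and K: "\<And>s. norm (B0 s) \<le> K * norm s" "K > 0"
    and close: "\<And>u. norm (A u - A0 u) \<le> norm u / (2 * K)"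
  shows "\<exists>B. linear B \<and> A \<circ> B = id \<and> (\<forall>s. norm (B s) \<le> 2 * K * norm s)"
proof -
  have linM: "linear (A \<circ> B0)"
    using lin by (simp add: linear_compose)
  have lower: "norm s \<le> 2 * norm (A (B0 s))" for s
  proof -
    have "norm (A (B0 s) - s) \<le> norm (B0 s) / (2 * K)"
      using close[of "B0 s"] inv by (metis comp_apply id_apply)
    also have "\<dots> \<le> norm s / 2"
      using K(1)[of s] K(2) by (simp add: field_simps)
    finally have "norm (A (B0 s) - s) \<le> norm s / 2" .
    moreover have "norm s \<le> norm (A (B0 s)) + norm (A (B0 s) - s)"
      using norm_triangle_ineq4[of "A (B0 s)" "A (B0 s) - s"] by simp
    ultimately show ?thesis
      by linarith
  qed
  have "inj (A \<circ> B0)"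
    unfolding linear_injective_0[OF linM]
  proof (intro allI impI)
    fix s
    assume "(A \<circ> B0) s = 0"
    then show "s = 0"
      using lower[of s] by simp
  qed
  then obtain N where N: "linear N" "(A \<circ> B0) \<circ> N = id"
    using linear_injective_isomorphism[OF linM] by (auto simp: fun_eq_iff)
  have "norm ((B0 \<circ> N) s) \<le> 2 * K * norm s" for s
  proof -
    have "norm (N s) \<le> 2 * norm s"
      using lower[of "N s"] N(2) by (metis comp_apply id_apply)
    then have "K * norm (N s) \<le> K * (2 * norm s)"
      using K(2) by simp
    then show ?thesis
      using K(1)[of "N s"] by simp
  qed
  moreover have "linear (B0 \<circ> N)"
    using N(1) lin(2) by (simp add: linear_compose)
  ultimately show ?thesis
    using N(2) by (metis comp_assoc)
qed

lemma norm_matrix_vector_mult_le: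
  fixes A :: "real^'n^'m"
  shows "norm (A *v u) \<le> norm A * norm u"
proof -
  have "norm (A *v u) = L2_set (\<lambda>i. \<bar>A $ i \<bullet> u\<bar>) UNIV"
    by (simp add: norm_vec_def matrix_vector_mul_component)
  also have "\<dots> \<le> L2_set (\<lambda>i. norm (A $ i) * norm u) UNIV"
    by (intro L2_set_mono Cauchy_Schwarz_ineq2) auto
  also have "\<dots> = norm A * norm u"
    by (simp add: norm_vec_def[of A] L2_set_left_distrib)
  finally show ?thesis .
qed

lemma locally_bounded_right_inverses:
  fixes F :: "real^'n \<Rightarrow> real^'m"
  assumes "continuously_differentiable F"
    and surj: "surj (\<lambda>v. jacobian F (at xbar) *v v)"
  shows "\<exists>K>0. \<exists>\<delta>>0. \<forall>x\<in>ball xbar \<delta>. \<exists>B. linear B \<and>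
    (\<lambda>v. jacobian F (at x) *v v) \<circ> B = id \<and> (\<forall>s. norm (B s) \<le> K * norm s)"
proof -
  let ?J = "\<lambda>x. jacobian F (at x)"
  obtain B0 where B0: "linear B0" "(\<lambda>v. ?J xbar *v v) \<circ> B0 = id"
    using linear_surjective_right_inverse[OF matrix_vector_mul_linear surj] by auto
  obtain K where K: "K > 0" "\<And>s. norm (B0 s) \<le> K * norm s"
    using linear_bounded_pos[OF B0(1)] by metis
  have "isCont ?J xbar"
    using assms(1) by (simp add: continuously_differentiable_def continuous_on_eq_continuous_at)
  moreover have "0 < 1 / (2 * K)"
    using K(1) by simp
  ultimately obtain \<delta> where \<delta>: "\<delta> > 0"
    and J: "\<And>x. dist x xbar < \<delta> \<Longrightarrow> dist (?J x) (?J xbar) < 1 / (2 * K)"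
    unfolding continuous_at_eps_delta by blast
  have "\<exists>B. linear B \<and> (\<lambda>v. ?J x *v v) \<circ> B = id \<and> (\<forall>s. norm (B s) \<le> 2 * K * norm s)"
    if "x \<in> ball xbar \<delta>" for x
  proof (rule right_inverse_perturbation[OF _ B0 K(2,1)])
    fix u
    have "norm (?J x *v u - ?J xbar *v u) \<le> norm (?J x - ?J xbar) * norm u"
      using norm_matrix_vector_mult_le[of "?J x - ?J xbar" u]
      by (simp add: matrix_vector_mult_diff_rdistrib)
    also have "\<dots> \<le> 1 / (2 * K) * norm u"
      using J[of x] that by (intro mult_right_mono) (auto simp: dist_norm norm_minus_commute)
    finally show "norm (?J x *v u - ?J xbar *v u) \<le> norm u / (2 * K)"
      by simp
  qed (rule matrix_vector_mul_linear)
  then show ?thesis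
    using \<delta> K(1) by (intro exI[of _ "2 * K"] conjI exI[of _ \<delta>]) auto
qed

section \<open>Limiting subgradients of a composition\<close>

text \<open>
  Take regular subgradients approximating \<open>v\<close> and push them forward. The images are bounded because
  \<open>K\<close> does not depend on the base point, so a subsequence converges, and its limit is a limiting
  subgradient of \<open>g\<close> inheriting the norm bound.
\<close>
lemma subdiff_comp_bound:
  fixes F :: "'a::euclidean_space \<Rightarrow> 'b::euclidean_space" and g :: "'b \<Rightarrow> ereal"
  assumes U: "open U" "x \<in> U"
    and cont: "continuous_on UNIV F"
    and reg: "\<And>z v. z \<in> U \<Longrightarrow> v \<in> regular_subdiff (g \<circ> F) z \<Longrightarrow>
                \<exists>w\<in>regular_subdiff g (F z). norm w \<le> K * norm v"
    and v: "v \<in> subdiff (g \<circ> F) x"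
  shows "\<exists>w\<in>subdiff g (F x). norm w \<le> K * norm v"
proof -
  obtain xs vs where xs: "xs \<longlonglongrightarrow> x" and gs: "(\<lambda>t. g (F (xs t))) \<longlonglongrightarrow> g (F x)"
    and vs: "vs \<longlonglongrightarrow> v" and rs: "\<And>t::nat. vs t \<in> regular_subdiff (g \<circ> F) (xs t)"
    and dom: "F x \<in> dom_fun g"
    using v by (auto simp: subdiff_def dom_fun_def split: if_splits)
  have "\<forall>\<^sub>F t in sequentially. xs t \<in> U"
    using topological_tendstoD[OF xs U] .
  then obtain t0 where t0: "\<And>t. t \<ge> t0 \<Longrightarrow> xs t \<in> U"
    by (auto simp: eventually_sequentially)
  have "\<forall>t. \<exists>w\<in>regular_subdiff g (F (xs (t + t0))). norm w \<le> K * norm (vs (t + t0))"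
    using reg[OF t0 rs] by simp
  then obtain ws where ws: "\<And>t. ws t \<in> regular_subdiff g (F (xs (t + t0)))"
    and wb: "\<And>t. norm (ws t) \<le> K * norm (vs (t + t0))"
    by metis
  have vb: "(\<lambda>t. K * norm (vs (t + t0))) \<longlonglongrightarrow> K * norm v"
    by (intro tendsto_intros LIMSEQ_ignore_initial_segment vs)
  then have "Bseq (\<lambda>t. K * norm (vs (t + t0)))"
    by (intro convergent_imp_Bseq convergentI)
  then have "bounded (range ws)"
    using wb unfolding Bseq_eq_bounded[symmetric]
    by (elim Bseq_eventually_mono[rotated])
       (auto intro!: always_eventually order_trans[OF _ abs_ge_self])
  then obtain w \<tau> where \<tau>: "strict_mono \<tau>" and w: "(ws \<circ> \<tau>) \<longlonglongrightarrow> w"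
    using bounded_imp_convergent_subsequence by blast
  define \<sigma> where "\<sigma> t = \<tau> t + t0" for t
  have \<sigma>: "strict_mono \<sigma>"
    using \<tau> by (simp add: \<sigma>_def strict_mono_def)
  have "((\<lambda>t. F (xs t)) \<circ> \<sigma>) \<longlonglongrightarrow> F x"
    by (intro LIMSEQ_subseq_LIMSEQ[OF _ \<sigma>] continuous_on_tendsto_compose[OF cont xs]) auto
  moreover have "((\<lambda>t. g (F (xs t))) \<circ> \<sigma>) \<longlonglongrightarrow> g (F x)"
    by (rule LIMSEQ_subseq_LIMSEQ[OF gs \<sigma>])
  moreover have "(ws \<circ> \<tau>) t \<in> regular_subdiff g (F (xs (\<sigma> t)))" for t
    using ws by (simp add: \<sigma>_def)
  ultimately have "\<exists>ys us. ys \<longlonglongrightarrow> F x \<and> (\<lambda>t. g (ys t)) \<longlonglongrightarrow> g (F x) \<and> us \<longlonglongrightarrow> w \<and>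
      (\<forall>t::nat. us t \<in> regular_subdiff g (ys t))"
    using w unfolding comp_def by blast
  then have "w \<in> subdiff g (F x)"
    using dom by (simp add: subdiff_def)
  moreover have "norm w \<le> K * norm v"
  proof (rule LIMSEQ_le)
    show "(\<lambda>t. norm ((ws \<circ> \<tau>) t)) \<longlonglongrightarrow> norm w"
      by (intro tendsto_norm w)
    show "(\<lambda>t. K * norm (vs (\<tau> t + t0))) \<longlonglongrightarrow> K * norm v"
      using LIMSEQ_subseq_LIMSEQ[OF vb \<tau>] by (simp add: o_def)
  qed (auto intro: wb)
  ultimately show ?thesis
    by blast
qed

text \<open>
  \<open>closed_fun\<close> uses punctured neighbourhoods, but \<open>F\<close> may take the value \<open>F x\<close> at points other
  than \<open>x\<close>; so the bound on \<open>g\<close> is first extended to the point \<open>F x\<close> itself.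
\<close>
lemma closed_fun_comp:
  fixes F :: "'a::topological_space \<Rightarrow> 'b::topological_space"
  assumes g: "closed_fun g" and cont: "continuous_on UNIV F"
  shows "closed_fun (g \<circ> F)"
  unfolding closed_fun_def
proof
  fix x
  show "(g \<circ> F) x \<le> Liminf (at x) (g \<circ> F)"
    unfolding le_Liminf_iff
  proof (intro allI impI)
    fix y
    assume y: "y < (g \<circ> F) x"
    have "\<forall>\<^sub>F z in at (F x). y < g z"
      using g y unfolding closed_fun_def by (metis comp_apply less_LiminfD less_le_trans)
    then have "\<forall>\<^sub>F z in nhds (F x). y < g z"
      using y by (auto simp: eventually_at_filter elim: eventually_mono)
    moreover have "filterlim F (nhds (F x)) (at x)"
      using cont by (simp add: continuous_on_def)
    ultimately show "\<forall>\<^sub>F z in at x. y < (g \<circ> F) z"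
      by (auto simp: filterlim_iff)
  qed
qed

section \<open>The KL property of the composition\<close>

theorem theorem3p2:
  fixes g :: "real^'m \<Rightarrow> ereal"
    and F :: "real^'n \<Rightarrow> real^'m"
    and f :: "real^'n \<Rightarrow> ereal"
    and xbar :: "real^'n"
    and \<alpha> :: real
  assumes "f = g \<circ> F"
    and "proper_fun g" and "closed_fun g"
    and "continuously_differentiable F"
    and "0 \<le> \<alpha>" and "\<alpha> < 1"
    and "KL_function g \<alpha>"
    and "xbar \<in> dom_subdiff f"
    and "surj (\<lambda>v. jacobian F (at xbar) *v v)"
  shows "KL_property_at f xbar \<alpha>"
proof -
  have cont: "continuous_on UNIV F"
    using assms(4) unfolding continuously_differentiable_def
    by (meson continuous_at_imp_continuous_on differentiable_imp_continuous_within)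
  have der: "(F has_derivative (\<lambda>v. jacobian F (at x) *v v)) (at x)" for x
    using assms(4) jacobian_works unfolding continuously_differentiable_def by blast
  have g_fin: "g y \<noteq> -\<infinity>" for y
    using assms(2) by (simp add: proper_fun_def)
  obtain K \<delta> where K: "K > 0" and \<delta>: "\<delta> > 0" and inv: "\<And>x. x \<in> ball xbar \<delta> \<Longrightarrow>
      \<exists>B. linear B \<and> (\<lambda>v. jacobian F (at x) *v v) \<circ> B = id \<and> (\<forall>s. norm (B s) \<le> K * norm s)"
    using locally_bounded_right_inverses[OF assms(4,9)] by blast
  have reg: "\<exists>w\<in>regular_subdiff g (F x). norm w \<le> K * norm v"
    if x: "x \<in> ball xbar \<delta>" and v: "v \<in> regular_subdiff (g \<circ> F) x" for x v
  proof -
    obtain B where B: "linear B" "(\<lambda>v. jacobian F (at x) *v v) \<circ> B = id"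
      and BK: "\<And>s. norm (B s) \<le> K * norm s"
      using inv[OF x] by blast
    have "adjoint B v \<in> regular_subdiff g (F x)"
      by (rule regular_subdiff_comp[OF v g_fin cont der B])
    moreover have "norm (adjoint B v) \<le> K * norm v"
    proof -
      let ?w = "adjoint B v"
      have "norm ?w * norm ?w = v \<bullet> B ?w"
        using adjoint_works[OF B(1), of ?w v]
        by (simp add: inner_commute dot_square_norm power2_eq_square)
      also have "\<dots> \<le> norm v * (K * norm ?w)"
        by (meson BK norm_cauchy_schwarz mult_left_mono norm_ge_zero order_trans)
      finally have "norm ?w * norm ?w \<le> (K * norm v) * norm ?w"
        by (simp add: mult_ac)
      then show ?thesis
        using K by (cases "norm ?w = 0") auto
    qed
    ultimately show ?thesis
      by blast
  qed
  have lim: "\<exists>w\<in>subdiff g (F x). norm w \<le> K * norm v"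
    if "x \<in> ball xbar \<delta>" "v \<in> subdiff f x" for x v
    using subdiff_comp_bound[OF open_ball that(1) cont reg] that(2) assms(1) by blast
  have "F xbar \<in> dom_subdiff g"
    using lim[of xbar] \<delta> assms(8) unfolding dom_subdiff_def by fastforce
  then have "KL_property_at g (F xbar) \<alpha>"
    using assms(7) by (simp add: KL_function_def)
  then obtain c \<epsilon> \<nu> where c: "0 < c" and \<epsilon>: "0 < \<epsilon>" and \<nu>: "0 < \<nu>"
    and KL: "\<And>y. norm (y - F xbar) \<le> \<epsilon> \<Longrightarrow> g (F xbar) < g y \<Longrightarrow> g y < g (F xbar) + \<nu> \<Longrightarrow>
      ereal (c * real_of_ereal (g y - g (F xbar)) powr \<alpha>) \<le> edist_set 0 (subdiff g y)"
    unfolding KL_property_at_def by blast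
  obtain \<eta> where \<eta>: "\<eta> > 0" and F\<eta>: "\<And>x. dist x xbar < \<eta> \<Longrightarrow> dist (F x) (F xbar) < \<epsilon>"
    using cont \<epsilon> unfolding continuous_on_iff by (metis UNIV_I)
  \<comment> \<open>The KL inequality is needed on a closed ball, hence a radius strictly below \<open>\<delta>\<close> and \<open>\<eta>\<close>.\<close>
  define \<mu> where "\<mu> = min \<delta> \<eta> / 2"
  have \<mu>: "0 < \<mu>" "\<mu> < \<delta>" "\<mu> < \<eta>"
    using \<delta> \<eta> by (auto simp: \<mu>_def)
  have "ereal (c / K * real_of_ereal (f x - f xbar) powr \<alpha>) \<le> edist_set 0 (subdiff f x)"
    if x: "norm (x - xbar) \<le> \<mu>" and lo: "f xbar < f x" and up: "f x < f xbar + \<nu>" for x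
    unfolding edist_set_def
  proof (rule INF_greatest)
    fix v
    assume "v \<in> subdiff f x"
    then obtain w where w: "w \<in> subdiff g (F x)" "norm w \<le> K * norm v"
      using lim[of x v] x \<mu>(2) by (auto simp: dist_norm norm_minus_commute)
    let ?p = "real_of_ereal (f x - f xbar) powr \<alpha>"
    have "norm (F x - F xbar) \<le> \<epsilon>"
      using F\<eta>[of x] x \<mu>(3) by (simp add: dist_norm)
    then have "ereal (c * ?p) \<le> edist_set 0 (subdiff g (F x))"
      using KL[of "F x"] lo up by (simp add: assms(1))
    also have "\<dots> \<le> ereal (norm w)"
      unfolding edist_set_def by (rule INF_lower2[OF w(1)]) simp
    finally have "c * ?p \<le> K * norm v"
      using w(2) by simp
    then show "ereal (c / K * ?p) \<le> ereal (dist 0 v)"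
      using K by (simp add: field_simps)
  qed
  moreover have "0 < c / K"
    using c K by simp
  moreover have "proper_fun f"
  proof -
    have "f xbar \<noteq> \<infinity>"
      using assms(8) by (auto simp: dom_subdiff_def subdiff_def dom_fun_def split: if_splits)
    then show ?thesis
      using g_fin assms(1) by (auto simp: proper_fun_def)
  qed
  moreover have "closed_fun f"
    unfolding assms(1) by (rule closed_fun_comp[OF assms(3) cont])
  ultimately show ?thesis
    unfolding KL_property_at_def using assms(5,6,8) \<mu>(1) \<nu> by blast
qed

end
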